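(* Let $\lambda\geq\mathfrak{c}$ be a cardinal number, let $V$ be a $\lambda$-dimensional Banach space over $\mathbb{K}$ and let $W$ be a closed vector subspace of $V$. If $V\setminus W$ is $\aleph_{0}$-lineable and $W$ has a regular basic sequence, then $V\setminus W$ is $(n,\mathfrak{c})$-spaceable in $V$, for every $n\in\mathbb{N}$.
   Context: $\mathbb{K}$ denotes $\mathbb{R}$ or $\mathbb{C}$; $\mathbb{N}$ is the set of positive integers; $\mathfrak{c}=\operatorname{card}(\mathbb{R})$; dimension means algebraic (Hamel) dimension. A sequence $(e_n)_{n=1}^\infty$ in a Banach space is a basic sequence if it is a Schauder basis of $\overline{\operatorname{span}\{e_n:n\in\mathbb{N}\}}$; a basic sequence is regular if it is bounded away from zero, i.e. it lies entirely outside some neighborhood of zero. A subset $A$ of a vector space $V$ is $\alpha$-lineable if $A\cup\{0\}$ contains an $\alpha$-dimensional vector subspace of $V$. For cardinals $\alpha\le\beta$ and $V$ endowed with a topology, a non-void subset $A\subset V$ is $(\alpha,\beta)$-spaceable if it is $\alpha$-lineable and for each $\alpha$-dimensional subspace $W_\alpha\subset A\cup\{0\}$ there is a closed $\beta$-dimensional subspace $W_\beta$ of $V$ with $W_\alpha\subset W_\beta\subset A\cup\{0\}$. *)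

theory Defs
  imports "HOL-Analysis.Analysis"
begin

unbundle cardinal_syntax

(* The scalar field K is a type of class {real_normed_field, euclidean_space}. The norm of such a
   field is multiplicative and its real dimension is finite, so by Frobenius it is isometrically
   isomorphic to the reals or to the complex numbers, and both types are instances. The norm,
   topology and completeness of the Banach space are those of 'v; the scalar multiplication by K
   is a parameter because the class banach only provides multiplication by reals. *)
locale banach_space_over = vector_space smul
  for smul :: "'k::{real_normed_field,euclidean_space} \<Rightarrow> 'v::banach \<Rightarrow> 'v" +
  assumes norm_smul: "norm (smul a x) = norm a * norm x"
    and smul_of_real: "smul (of_real r) x = r *\<^sub>R x"

(* Cardinals are cardinal orders: natLeq for aleph_0, |UNIV :: real set| for the continuum,
   |{..<n}| for n. *)

definition has_hamel_dim ::
  "('k::field \<Rightarrow> 'v::ab_group_add \<Rightarrow> 'v) \<Rightarrow> 'v set \<Rightarrow> 'c rel \<Rightarrow> bool" where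
  "has_hamel_dim smul S \<alpha> \<longleftrightarrow>
     (\<exists>B. \<not> module.dependent smul B \<and> module.span smul B = S \<and> |B| =o \<alpha>)"

definition lineable ::
  "('k::field \<Rightarrow> 'v::ab_group_add \<Rightarrow> 'v) \<Rightarrow> 'c rel \<Rightarrow> 'v set \<Rightarrow> bool" where
  "lineable smul \<alpha> A \<longleftrightarrow>
     (\<exists>S. module.subspace smul S \<and> has_hamel_dim smul S \<alpha> \<and> S \<subseteq> A \<union> {0})"

definition spaceable ::
  "('k::field \<Rightarrow> 'v::{ab_group_add,topological_space} \<Rightarrow> 'v) \<Rightarrow> 'c rel \<Rightarrow> 'd rel \<Rightarrow> 'v set \<Rightarrow> bool" where
  "spaceable smul \<alpha> \<beta> A \<longleftrightarrow>
     \<alpha> \<le>o \<beta> \<and> A \<noteq> {} \<and> lineable smul \<alpha> A \<and>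
     (\<forall>S. module.subspace smul S \<and> has_hamel_dim smul S \<alpha> \<and> S \<subseteq> A \<union> {0} \<longrightarrow>
        (\<exists>T. module.subspace smul T \<and> closed T \<and> has_hamel_dim smul T \<beta> \<and>
             S \<subseteq> T \<and> T \<subseteq> A \<union> {0}))"

(* Sequences are indexed from 0; the series converge in norm. *)
definition schauder_basis ::
  "('k::field \<Rightarrow> 'v::real_normed_vector \<Rightarrow> 'v) \<Rightarrow> (nat \<Rightarrow> 'v) \<Rightarrow> 'v set \<Rightarrow> bool" where
  "schauder_basis smul e X \<longleftrightarrow>
     range e \<subseteq> X \<and> (\<forall>x\<in>X. \<exists>!a :: nat \<Rightarrow> 'k. (\<lambda>n. smul (a n) (e n)) sums x)"

definition basic_sequence ::
  "('k::field \<Rightarrow> 'v::real_normed_vector \<Rightarrow> 'v) \<Rightarrow> (nat \<Rightarrow> 'v) \<Rightarrow> bool" where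
  "basic_sequence smul e \<longleftrightarrow> schauder_basis smul e (closure (module.span smul (range e)))"

definition regular_basic_sequence ::
  "('k::field \<Rightarrow> 'v::real_normed_vector \<Rightarrow> 'v) \<Rightarrow> (nat \<Rightarrow> 'v) \<Rightarrow> bool" where
  "regular_basic_sequence smul e \<longleftrightarrow>
     basic_sequence smul e \<and> (\<exists>U. open U \<and> 0 \<in> U \<and> range e \<inter> U = {})"

end

theory Submission
  imports Defs
begin

text \<open>
  Let \<open>S\<close> be a finite-dimensional subspace with \<open>S \<inter> W = {0}\<close>. A closed subspace \<open>T \<supseteq> S\<close> that also meets
  \<open>W\<close> only in \<open>0\<close> is obtained by tilting a closed subspace \<open>E\<close> of \<open>W\<close> out of \<open>W\<close>. Let \<open>E\<close> be the closed
  span of the given basic sequence. If \<open>K\<close> is a linear operator of norm at most \<open>1/2\<close>, then \<open>I + K\<close> is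
  bounded below, so \<open>(I + K) E\<close> is closed, and so is \<open>T = (I + K) E + S\<close>. An element \<open>u + K u + s\<close> of \<open>T\<close>
  with \<open>u \<in> E\<close> and \<open>s \<in> S\<close> can lie in \<open>W\<close> only if \<open>K u \<in> W + S\<close>, because \<open>u \<in> W\<close>. So it suffices that
  \<open>K u \<in> W + S\<close> forces \<open>u = 0\<close> for \<open>u \<in> E\<close>: then the element is \<open>s\<close>, and \<open>S \<inter> W = {0}\<close> finishes.

  Such an operator is a rapidly convergent series \<open>K u = (\<Sum>k. \<delta>\<^sub>k g\<^sub>k(u) x\<^sub>k)\<close>. The bounded functionals \<open>g\<^sub>k\<close>
  are chosen to have no common zero in \<open>E\<close> other than \<open>0\<close>, which is possible because \<open>E\<close> is separable
  (\<open>exists_total_functionals\<close>). The vectors \<open>x\<^sub>k\<close> come with bounded functionals \<open>f\<^sub>k\<close> that vanish on the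
  closed subspace \<open>W + S\<close> and satisfy \<open>f\<^sub>i(x\<^sub>k) = 0\<close> for \<open>i < k\<close> and \<open>f\<^sub>k(x\<^sub>k) \<noteq> 0\<close>; since \<open>W\<close>, and hence
  \<open>W + S\<close>, has infinite codimension, they can be picked one after the other (\<open>exists_triangular_system\<close>).
  If \<open>K u \<in> W + S\<close>, then applying \<open>f\<^sub>0, f\<^sub>1, \<dots>\<close> in turn shows that every \<open>g\<^sub>k(u)\<close> vanishes.

  All functionals come from a geometric Hahn-Banach theorem over the scalar field
  (\<open>exists_functional_avoiding_ball\<close>): a subspace that misses a ball lies in the kernel of a bounded
  functional whose kernel misses the ball.

  It remains to see that \<open>T\<close> has dimension \<open>\<cc>\<close>, the cardinality of the continuum. It is separable, so it
  has at most \<open>\<cc>\<close> points. Being closed and infinite-dimensional, it contains a triangular system \<open>(x\<^sub>k)\<close>,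
  this time for the subspace \<open>{0}\<close>, and the sums of \<open>\<Sum>k. t\<^sup>k x\<^sub>k / \<parallel>x\<^sub>k\<parallel>\<close> with \<open>0 < t < 1\<close> are linearly
  independent, because a finite relation among them is a relation among the sequences \<open>(t\<^sup>k)\<close>
  (\<open>exists_continuum_independent_family\<close>).
\<close>

section \<open>Separating a subspace from a ball by a bounded functional\<close>

text \<open>
  Suppose \<open>y\<close> is outside \<open>M + \<real>v\<close>. By maximality, adding any \<open>y + t v\<close> to \<open>M\<close> produces a point of the
  ball, with either a positive or a negative coefficient of \<open>y + t v\<close>. Each sign occurs for an open set of \<open>t\<close>,
  and each occurs for some \<open>t\<close> of large modulus. Both signs for the same \<open>t\<close> would give a convex combination
  in which \<open>y + t v\<close> cancels, that is, a point of \<open>M\<close> in the ball. So the two sets of \<open>t\<close> would disconnect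
  the line.
\<close>
lemma maximal_subspace_avoiding_ball_hyperplane:
  fixes v :: "'a::real_normed_vector"
  assumes M: "subspace M" and avoid: "ball v r \<inter> M = {}" and r: "0 < r"
    and max: "\<And>X. \<lbrakk>subspace X; M \<subseteq> X; ball v r \<inter> X = {}\<rbrakk> \<Longrightarrow> X = M"
  shows "\<exists>t. y - t *\<^sub>R v \<in> M"
proof (rule ccontr)
  assume "\<nexists>t. y - t *\<^sub>R v \<in> M"
  then have no: "y - t *\<^sub>R v \<notin> M" for t by blast
  define hits where "hits \<sigma> = {t. \<exists>s>0. \<exists>m\<in>M. (\<sigma> * s) *\<^sub>R (y + t *\<^sub>R v) + m \<in> ball v r}" for \<sigma> :: real
  have hits_open: "open (hits \<sigma>)" for \<sigma>
  proof -
    let ?H = "\<lambda>s m t. (\<sigma> * s) *\<^sub>R (y + t *\<^sub>R v) + m"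
    have union: "{t. \<exists>s>0. \<exists>m\<in>M. P s m t} = (\<Union>s\<in>{0<..}. \<Union>m\<in>M. {t. P s m t})"
      for P :: "real \<Rightarrow> 'a \<Rightarrow> real \<Rightarrow> bool" by auto
    have "open {t. ?H s m t \<in> ball v r}" for s m
      by (rule open_vimage[OF open_ball, unfolded vimage_def]) (intro continuous_intros)
    then show ?thesis
      unfolding hits_def union by (intro open_UN ballI)
  qed
  have cover: "hits 1 \<union> hits (-1) = UNIV"
  proof -
    have "t \<in> hits 1 \<union> hits (-1)" for t
    proof -
      let ?X = "span (insert (y + t *\<^sub>R v) M)"
      have "y + t *\<^sub>R v \<notin> M" 
        using no[of "- t"] by simp
      moreover have "y + t *\<^sub>R v \<in> ?X" by (simp add: span_base)
      ultimately have "?X \<noteq> M" by metis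
      then have "ball v r \<inter> ?X \<noteq> {}"
        using max[of ?X] span_superset[of "insert (y + t *\<^sub>R v) M"] by auto
      then obtain z where z: "z \<in> ball v r" "z \<in> ?X" by blast
      have "span M = M" using M by simp
      then obtain s where s: "z - s *\<^sub>R (y + t *\<^sub>R v) \<in> M"
        using z(2) unfolding span_breakdown_eq by metis
      have "s \<noteq> 0" using s z avoid by auto
      define \<sigma> where "\<sigma> = sgn s"
      have *: "s = \<sigma> * \<bar>s\<bar>" "\<bar>s\<bar> > 0" "\<sigma> = 1 \<or> \<sigma> = -1"
        using \<open>s \<noteq> 0\<close> by (auto simp: \<sigma>_def sgn_if)
      have "(\<sigma> * \<bar>s\<bar>) *\<^sub>R (y + t *\<^sub>R v) + (z - s *\<^sub>R (y + t *\<^sub>R v)) = z"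
        unfolding *(1)[symmetric] by simp
      then have "t \<in> hits \<sigma>" unfolding hits_def using s z(1) *(2) by (metis (mono_tags, lifting) mem_Collect_eq)
      then show ?thesis using *(3) by auto
    qed
    then show ?thesis by auto
  qed
  have disjoint: "hits 1 \<inter> hits (-1) = {}"
  proof (rule ccontr)
    assume "hits 1 \<inter> hits (-1) \<noteq> {}"
    then obtain t p m q l where pq: "p > 0" "q > 0" "m \<in> M" "l \<in> M"
      and a: "p *\<^sub>R (y + t *\<^sub>R v) + m \<in> ball v r" and b: "(- q) *\<^sub>R (y + t *\<^sub>R v) + l \<in> ball v r"
      unfolding hits_def by auto
    \<comment> \<open>Weights for which the two multiples of \<open>y + t v\<close> cancel.\<close>
    let ?u = "q / (p + q)" and ?w = "p / (p + q)"
    have "?u *\<^sub>R (p *\<^sub>R (y + t *\<^sub>R v) + m) + ?w *\<^sub>R ((- q) *\<^sub>R (y + t *\<^sub>R v) + l) \<in> ball v r"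
      using pq by (intro convexD[OF convex_ball a b]) (simp_all add: add.commute flip: add_divide_distrib)
    moreover have "?u *\<^sub>R (p *\<^sub>R (y + t *\<^sub>R v) + m) + ?w *\<^sub>R ((- q) *\<^sub>R (y + t *\<^sub>R v) + l) = ?u *\<^sub>R m + ?w *\<^sub>R l"
      by (simp add: algebra_simps)
    ultimately show False
      using avoid pq(3,4) M by (metis IntI empty_iff subspace_add subspace_scale)
  qed
  have far: "\<exists>t. t \<in> hits \<sigma>" if "\<bar>\<sigma>\<bar> = 1" for \<sigma>
  proof -
    \<comment> \<open>With coefficient \<open>\<sigma> s\<close> and \<open>t = \<sigma> / s\<close> the point is \<open>v + \<sigma> s y\<close>, which lies in the ball as \<open>s \<parallel>y\<parallel> < r\<close>.\<close>
    define s where "s = r / (norm y + 1)"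
    have pos: "0 < norm y + 1" by (simp add: add_nonneg_pos)
    have "r * norm y < r * (norm y + 1)"
      using r by simp
    then have s: "s > 0" "s * norm y < r"
      unfolding s_def using r pos by (simp_all add: divide_less_eq)
    have "\<sigma> * \<sigma> = 1" using that by (metis abs_mult_self_eq mult_1)
    then have "(\<sigma> * s) *\<^sub>R (y + (\<sigma> / s) *\<^sub>R v) + 0 = v + (\<sigma> * s) *\<^sub>R y"
      using s(1) by (simp add: scaleR_add_right)
    also have "\<dots> \<in> ball v r"
      using s that by (simp add: dist_norm abs_mult)
    finally show ?thesis
      unfolding hits_def using s(1) subspace_0[OF M] by blast
  qed
  show False
    using connectedD[OF connected_UNIV hits_open hits_open, of 1 "-1"] cover disjoint far[of 1] far[of "-1"]
    by auto
qed

text \<open>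
  By Zorn's lemma \<open>N\<close> extends to a maximal subspace \<open>M\<close> that misses the ball. Every vector is congruent to
  a unique multiple of \<open>v\<close> modulo \<open>M\<close>, and the functional reads off this multiple. It is bounded by \<open>1/r\<close>
  because \<open>v\<close> has distance at least \<open>r\<close> from \<open>M\<close>.
\<close>
lemma exists_real_functional_avoiding_ball:
  fixes v :: "'a::real_normed_vector"
  assumes N: "subspace N" and avoid: "ball v r \<inter> N = {}" and r: "0 < r"
  shows "\<exists>\<phi> :: 'a \<Rightarrow> real. bounded_linear \<phi> \<and> (\<forall>x\<in>N. \<phi> x = 0) \<and> (\<forall>x. \<phi> x = 0 \<longrightarrow> x \<notin> ball v r)"
proof -
  define \<A> where "\<A> = {M. subspace M \<and> N \<subseteq> M \<and> ball v r \<inter> M = {}}"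
  have "\<exists>M\<in>\<A>. \<forall>X\<in>\<A>. M \<subseteq> X \<longrightarrow> X = M"
  proof (rule subset_Zorn_nonempty)
    show "\<A> \<noteq> {}" using assms by (auto simp: \<A>_def)
    fix \<C> assume ne: "\<C> \<noteq> {}" and ch: "subset.chain \<A> \<C>"
    have sub: "M \<in> \<A>" if "M \<in> \<C>" for M using ch that by (auto simp: subset_chain_def)
    have "subspace (\<Union>\<C>)"
    proof (rule subspaceI)
      show "0 \<in> \<Union>\<C>" using ne sub by (force simp: \<A>_def subspace_0)
      show "c *\<^sub>R x \<in> \<Union>\<C>" if "x \<in> \<Union>\<C>" for c x
        using that sub by (auto simp: \<A>_def intro: subspace_scale)
      show "x + y \<in> \<Union>\<C>" if "x \<in> \<Union>\<C>" "y \<in> \<Union>\<C>" for x y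
      proof -
        obtain X Y where XY: "X \<in> \<C>" "Y \<in> \<C>" "x \<in> X" "y \<in> Y"
          using \<open>x \<in> \<Union>\<C>\<close> \<open>y \<in> \<Union>\<C>\<close> by blast
        then have "X \<subseteq> Y \<or> Y \<subseteq> X" using ch by (auto simp: subset_chain_def)
        then obtain Z where "Z \<in> \<C>" "x \<in> Z" "y \<in> Z" using XY by blast
        then show ?thesis using sub[of Z] by (auto simp: \<A>_def intro: subspace_add)
      qed
    qed
    moreover have "N \<subseteq> \<Union>\<C>" using ne sub unfolding \<A>_def by blast
    moreover have "ball v r \<inter> \<Union>\<C> = {}" using sub unfolding \<A>_def by blast
    ultimately show "\<Union>\<C> \<in> \<A>" by (simp add: \<A>_def)
  qed
  then obtain M where "M \<in> \<A>" and maxA: "\<forall>X\<in>\<A>. M \<subseteq> X \<longrightarrow> X = M" by blast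
  then have M: "subspace M" "N \<subseteq> M" "ball v r \<inter> M = {}" by (simp_all add: \<A>_def)
  have max: "X = M" if "subspace X" "M \<subseteq> X" "ball v r \<inter> X = {}" for X
    using maxA that M(2) by (simp add: \<A>_def)
  have hyper: "\<exists>t. y - t *\<^sub>R v \<in> M" for y
    using M(1,3) r by (rule maximal_subspace_avoiding_ball_hyperplane) (rule max)
  then obtain \<phi> where \<phi>: "\<And>y. y - \<phi> y *\<^sub>R v \<in> M" by metis
  have v: "v \<notin> M" using M(3) centre_in_ball[of v r] r by blast
  have uniq: "\<phi> y = t" if "y - t *\<^sub>R v \<in> M" for y t
  proof (rule ccontr)
    assume "\<phi> y \<noteq> t"
    have "(y - t *\<^sub>R v) - (y - \<phi> y *\<^sub>R v) \<in> M"
      using that \<phi> M(1) by (rule_tac subspace_diff)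
    then have "(\<phi> y - t) *\<^sub>R v \<in> M" by (simp add: algebra_simps)
    then show False using v M(1) \<open>\<phi> y \<noteq> t\<close> subspace_scale[OF M(1), of "(\<phi> y - t) *\<^sub>R v" "inverse (\<phi> y - t)"] by simp
  qed
  have add: "\<phi> (x + y) = \<phi> x + \<phi> y" for x y
    using subspace_add[OF M(1) \<phi>[of x] \<phi>[of y]] by (intro uniq) (simp add: algebra_simps)
  have scale: "\<phi> (c *\<^sub>R x) = c *\<^sub>R \<phi> x" for c x
    using subspace_scale[OF M(1) \<phi>[of x], of c] by (intro uniq) (simp add: algebra_simps)
  have bound: "norm (\<phi> x) \<le> norm x * inverse r" for x
  proof (cases "\<phi> x = 0")
    case False
    have "- inverse (\<phi> x) *\<^sub>R (x - \<phi> x *\<^sub>R v) \<in> M"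
      by (rule subspace_scale[OF M(1) \<phi>])
    moreover have "- inverse (\<phi> x) *\<^sub>R (x - \<phi> x *\<^sub>R v) = v - inverse (\<phi> x) *\<^sub>R x"
      using False by (simp add: algebra_simps)
    ultimately have "r \<le> norm (inverse (\<phi> x) *\<^sub>R x)"
      using M(3) by (force simp: dist_norm)
    then show ?thesis using False r by (simp add: field_simps)
  qed (use r in auto)
  have "bounded_linear \<phi>" by (rule bounded_linear_intro[OF add scale bound])
  moreover have "x \<notin> ball v r" if "\<phi> x = 0" for x using \<phi>[of x] that M(3) by auto
  moreover have "\<phi> x = 0" if "x \<in> N" for x using uniq[of x 0] that M(2) by auto
  ultimately show ?thesis by blast
qed

lemma exists_ball_avoiding_closed:
  fixes x :: "'a::metric_space"
  assumes "closed N" "x \<notin> N"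
  shows "\<exists>r>0. ball x r \<inter> N = {}"
proof -
  have "open (- N)" using assms(1) by (rule open_Compl)
  then obtain r where "r > 0" "ball x r \<subseteq> - N"
    using assms(2) openE[of "- N" x] by blast
  then show ?thesis by blast
qed

context banach_space_over
begin

lemma real_subspace: "subspace M \<Longrightarrow> Real_Vector_Spaces.subspace M"
  by (metis Real_Vector_Spaces.subspaceI smul_of_real subspace_0 subspace_add subspace_scale)

lemma bounded_linear_smul_right: "bounded_linear (smul a)"
  by (rule bounded_linear_intro[of _ "norm a"])
    (auto simp: scale_right_distrib norm_smul mult.commute simp flip: smul_of_real)

lemma bounded_linear_smul_left: "bounded_linear (\<lambda>a. smul a x)"
  by (rule bounded_linear_intro[of _ "norm x"])
    (auto simp: scale_left_distrib norm_smul scaleR_conv_of_real simp flip: smul_of_real)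

text \<open>
  The predicate \<open>bounded_linear\<close> only covers real scalars; homogeneity for all scalars is added.
\<close>
definition bounded_functional :: "('v \<Rightarrow> 'k) \<Rightarrow> bool" where
  "bounded_functional f \<longleftrightarrow> bounded_linear f \<and> (\<forall>a x. f (smul a x) = a * f x)"

lemma bounded_functionalD:
  assumes "bounded_functional f"
  shows "bounded_linear f" "f (smul a x) = a * f x"
  using assms by (auto simp: bounded_functional_def)

lemma bounded_functional_linear:
  assumes "bounded_functional f"
  shows "f (x + y) = f x + f y" "f (x - y) = f x - f y" "f 0 = 0"
proof -
  interpret bounded_linear f using assms by (rule bounded_functionalD)
  show "f (x + y) = f x + f y" "f (x - y) = f x - f y" "f 0 = 0" by (rule add diff zero)+
qed

text \<open>
  A real functional \<open>\<phi>\<close> becomes linear over the scalar field \<open>K\<close> as follows. For fixed \<open>x\<close>, the real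
  functional \<open>a \<mapsto> \<phi>(a x)\<close> on the finite-dimensional space \<open>K\<close> has the form \<open>a \<mapsto> inner 1 (a c)\<close> for a unique
  \<open>c \<in> K\<close>, since the bilinear form \<open>inner 1 (a c)\<close> is nondegenerate: put \<open>a = 1/c\<close>. Uniqueness makes
  \<open>f(x) = c\<close> linear over \<open>K\<close>. Over the complex numbers this is the usual passage from a real part to the
  functional, in a form that does not refer to the imaginary unit.
\<close>
lemma exists_functional_avoiding_ball:
  assumes N: "subspace N" and avoid: "ball v r \<inter> N = {}" and r: "0 < r"
  shows "\<exists>f. bounded_functional f \<and> (\<forall>x\<in>N. f x = 0) \<and> (\<forall>x. f x = 0 \<longrightarrow> x \<notin> ball v r)"
proof -
  obtain \<phi> :: "'v \<Rightarrow> real" where \<phi>: "bounded_linear \<phi>" "\<And>x. x \<in> N \<Longrightarrow> \<phi> x = 0" "\<And>x. \<phi> x = 0 \<Longrightarrow> x \<notin> ball v r"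
    using exists_real_functional_avoiding_ball[OF real_subspace[OF N] avoid r] by metis
  interpret \<phi>: bounded_linear \<phi> by fact
  \<comment> \<open>\<open>L c\<close> represents the functional \<open>a \<mapsto> inner 1 (a c)\<close> with respect to the inner product.\<close>
  define L :: "'k \<Rightarrow> 'k" where "L c = (\<Sum>b\<in>Basis. inner 1 (b * c) *\<^sub>R b)" for c
  have L: "linear L" unfolding L_def
    by (intro linearI) (simp_all add: algebra_simps inner_add_right sum.distrib scaleR_sum_right)
  have inner_L: "inner (L c) a = inner 1 (a * c)" for c a
  proof -
    have "inner 1 (a * c) = inner 1 ((\<Sum>b\<in>Basis. inner a b *\<^sub>R b) * c)"
      by (simp add: euclidean_representation)
    also have "\<dots> = (\<Sum>b\<in>Basis. inner a b * inner 1 (b * c))"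
      by (simp add: sum_distrib_right inner_sum_right)
    also have "\<dots> = inner (L c) a"
      by (simp add: L_def inner_sum_left inner_sum_right inner_commute[of _ a] mult.commute)
    finally show ?thesis by simp
  qed
  have "inj L"
  proof (subst linear_injective_0[OF L], intro allI impI, rule ccontr)
    fix c assume "L c = 0" "c \<noteq> 0"
    then show False using inner_L[of c "inverse c"] by simp
  qed
  then obtain R where R: "linear R" "\<And>c. L (R c) = c"
    by (metis L comp_apply id_apply linear_injective_imp_surjective linear_surjective_right_inverse)
  define f where "f x = R (\<Sum>b\<in>Basis. \<phi> (smul b x) *\<^sub>R b)" for x
  have f: "inner 1 (a * f x) = \<phi> (smul a x)" for a x
  proof -
    have "bounded_linear (\<lambda>a. \<phi> (smul a x))"
      using bounded_linear_compose[OF \<phi>(1) bounded_linear_smul_left] .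
    then interpret B: bounded_linear "\<lambda>a. \<phi> (smul a x)" .
    have "inner 1 (a * f x) = inner (\<Sum>b\<in>Basis. \<phi> (smul b x) *\<^sub>R b) a"
      unfolding inner_L[symmetric] f_def R(2) ..
    also have "\<dots> = (\<Sum>b\<in>Basis. inner a b *\<^sub>R \<phi> (smul b x))"
      by (simp add: inner_sum_left inner_sum_right inner_commute[of _ a] mult.commute)
    also have "\<dots> = \<phi> (smul (\<Sum>b\<in>Basis. inner a b *\<^sub>R b) x)"
      by (simp add: B.sum B.scaleR)
    finally show ?thesis by (simp add: euclidean_representation)
  qed
  have eqI: "c = d" if "\<And>a. inner 1 (a * c) = inner 1 (a * d)" for c d :: 'k
    using \<open>inj L\<close> that by (metis inj_def inner_L vector_eq_ldot inner_commute)
  have "bounded_linear f" unfolding f_def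
    by (intro bounded_linear_compose[OF linear_conv_bounded_linear[THEN iffD1, OF R(1)]]
        bounded_linear_sum bounded_linear_scaleR_const
        bounded_linear_compose[OF \<phi>(1) bounded_linear_smul_right])
  moreover have "f (smul a x) = a * f x" for a x
    by (rule eqI) (simp add: f flip: mult.assoc)
  moreover have "f x = 0" if "x \<in> N" for x
    by (rule eqI) (simp add: f \<phi>(2) subspace_scale[OF N that])
  moreover have "x \<notin> ball v r" if "f x = 0" for x
    using f[of 1 x] that \<phi>(3) by simp
  ultimately show ?thesis unfolding bounded_functional_def by blast
qed

section \<open>Closed subspaces\<close>

lemma subspace_closure:
  assumes "subspace M"
  shows "subspace (closure M)"
proof (rule subspaceI)
  show "0 \<in> closure M" using assms closure_subset subspace_0 by blast
  show "x + y \<in> closure M" if xy: "x \<in> closure M" "y \<in> closure M" for x y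
  proof -
    have "(\<lambda>(x, y). x + y) ` closure (M \<times> M) \<subseteq> closure M"
      by (rule image_closure_subset)
        (use assms closure_subset[of M] in \<open>auto simp: case_prod_unfold subspace_add subset_eq intro!: continuous_intros\<close>)
    then show ?thesis using xy by (auto simp: closure_Times)
  qed
  show "smul c x \<in> closure M" if x: "x \<in> closure M" for c x
  proof -
    have "smul c ` closure M \<subseteq> closure M"
      by (rule image_closure_subset)
        (use assms closure_subset[of M] in \<open>auto simp: subspace_scale subset_eq
            intro!: linear_continuous_on[OF bounded_linear_smul_right]\<close>)
    then show ?thesis using x by auto
  qed
qed

text \<open>
  A functional that vanishes on \<open>M\<close> but not at \<open>x\<close> gives a continuous formula for the coefficient of \<open>x\<close>,
  so the span is the preimage of \<open>M\<close> under a continuous map.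
\<close>
lemma closed_span_insert:
  assumes M: "subspace M" "closed M"
  shows "closed (span (insert x M))"
proof -
  have spanM: "span M = M" using M(1) by simp
  show ?thesis
  proof (cases "x \<in> M")
    case True
    show ?thesis unfolding insert_absorb[OF True] spanM by (rule M(2))
  next
    case False
    obtain r where r: "0 < r" "ball x r \<inter> M = {}"
      using exists_ball_avoiding_closed[OF M(2) False] by blast
    obtain f where f: "bounded_functional f" "\<And>y. y \<in> M \<Longrightarrow> f y = 0" "\<And>y. f y = 0 \<Longrightarrow> y \<notin> ball x r"
      using exists_functional_avoiding_ball[OF M(1) r(2,1)] by metis
    have "f x \<noteq> 0" using f(3)[of x] r by auto
    have "span (insert x M) = (\<lambda>y. y - smul (f y / f x) x) -` M"
    proof (intro set_eqI)
      fix y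
      have "y - smul k x \<in> M \<Longrightarrow> k = f y / f x" for k
        using f(2)[of "y - smul k x"] \<open>f x \<noteq> 0\<close>
        by (simp add: bounded_functional_linear[OF f(1)] bounded_functionalD[OF f(1)])
      then show "y \<in> span (insert x M) \<longleftrightarrow> y \<in> (\<lambda>y. y - smul (f y / f x) x) -` M"
        unfolding span_breakdown_eq spanM vimage_def by blast
    qed
    also have "closed \<dots>"
      by (intro closed_vimage[OF M(2)] continuous_intros
          linear_continuous_on[OF bounded_linear_compose[OF bounded_linear_smul_left, of "\<lambda>y. f y / f x"]]
          bounded_linear_compose[OF bounded_linear_divide bounded_functionalD(1)[OF f(1)]])
    finally show ?thesis .
  qed
qed

lemma closed_span_Un_finite:
  assumes "finite F" and M: "subspace M" "closed M"
  shows "closed (span (M \<union> F))"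
  using assms(1)
proof induction
  case empty
  have "span M = M" using M(1) by simp
  then show ?case using M(2) by (metis sup_bot_right)
next
  case (insert x F)
  have "span (M \<union> insert x F) = span (insert x (span (M \<union> F)))"
    by (simp add: span_insert span_span)
  then show ?case using closed_span_insert[OF subspace_span insert.IH] by simp
qed

section \<open>Linear independence and infinite codimension\<close>

text \<open>
  Independence of an indexed family is easier to verify than that of a set, and it excludes repetitions.
\<close>
lemma independent_familyI:
  assumes zero: "\<And>A r i. \<lbrakk>finite A; A \<subseteq> I; (\<Sum>j\<in>A. smul (r j) (v j)) = 0; i \<in> A\<rbrakk> \<Longrightarrow> r i = 0"
  shows "inj_on v I" "independent (v ` I)"
proof -
  show inj: "inj_on v I"
  proof (rule inj_onI, rule ccontr)
    fix i j assume ij: "i \<in> I" "j \<in> I" "v i = v j" "i \<noteq> j"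
    have "(\<Sum>k\<in>{i, j}. smul (if k = i then 1 else - 1) (v k)) = 0"
      using ij by simp
    from zero[OF _ _ this, of i] show False using ij by simp
  qed
  show "independent (v ` I)"
    unfolding independent_explicit_module
  proof (intro allI impI)
    fix B u w assume B: "finite B" "B \<subseteq> v ` I" "(\<Sum>x\<in>B. smul (u x) x) = 0" "w \<in> B"
    obtain A where A: "A \<subseteq> I" "B = v ` A" using B(2) by (meson subset_imageE)
    have injA: "inj_on v A" using inj A(1) by (rule inj_on_subset)
    have "finite A" using B(1) A(2) injA finite_image_iff by blast
    moreover have "(\<Sum>j\<in>A. smul (u (v j)) (v j)) = 0"
      using B(3) unfolding A(2) by (simp add: sum.reindex[OF injA] o_def)
    moreover obtain i where "i \<in> A" "w = v i" using B(4) A(2) by blast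
    ultimately show "u w = 0" using zero[of A "\<lambda>j. u (v j)" i] A(1) by simp
  qed
qed

text \<open>
  The coefficients of the zero vector are unique.
\<close>
lemma basic_sequence_independent:
  assumes "basic_sequence smul e"
  shows "inj e" "independent (range e)"
proof -
  have zero: "r i = 0" if A: "finite A" "(\<Sum>j\<in>A. smul (r j) (e j)) = 0" "i \<in> A" for A r i
  proof -
    have "0 \<in> closure (span (range e))" using span_zero closure_subset by blast
    then have "\<exists>!a. (\<lambda>n. smul (a n) (e n)) sums 0"
      using assms unfolding basic_sequence_def schauder_basis_def by blast
    then have uniq: "a = b" if "(\<lambda>n. smul (a n) (e n)) sums 0" "(\<lambda>n. smul (b n) (e n)) sums 0" for a b
      using that by (auto elim!: ex1E)
    have "(\<lambda>n. smul (if n \<in> A then r n else 0) (e n)) sums (\<Sum>n\<in>A. smul (if n \<in> A then r n else 0) (e n))"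
      using A(1) by (intro sums_finite) auto
    also have "(\<Sum>n\<in>A. smul (if n \<in> A then r n else 0) (e n)) = 0"
      using A(2) by simp
    finally have "(\<lambda>n. smul (if n \<in> A then r n else 0) (e n)) sums 0" .
    moreover have "(\<lambda>n. smul 0 (e n)) sums 0" by simp
    ultimately have "(\<lambda>n. if n \<in> A then r n else 0) = (\<lambda>_. 0)" by (rule uniq)
    then show ?thesis using A(3) by metis
  qed
  show "inj e" "independent (range e)"
    by (rule independent_familyI, rule zero, assumption+)+
qed

text \<open>
  Modulo \<open>W\<close> every element of \<open>B\<close> would have a representative in \<open>span F\<close>. The representatives are again
  independent, because \<open>span B\<close> meets \<open>W\<close> trivially, and there are infinitely many of them in a
  finite-dimensional space.
\<close>
lemma independent_not_subset_span_Un_finite: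
  assumes W: "subspace W" and B: "independent B" "infinite B" "span B \<inter> W \<subseteq> {0}" and F: "finite F"
  shows "\<not> B \<subseteq> span (W \<union> F)"
proof
  assume sub: "B \<subseteq> span (W \<union> F)"
  have spanW: "span W = W" using W by simp
  have "\<exists>y\<in>span F. b - y \<in> W" if "b \<in> B" for b
  proof -
    have "b \<in> {x + y |x y. x \<in> W \<and> y \<in> span F}"
      using sub that unfolding span_Un spanW by blast
    then obtain w y where "w \<in> W" "y \<in> span F" "b = w + y" by blast
    then show ?thesis by (intro bexI[of _ y]) simp_all
  qed
  then obtain h where h: "\<And>b. b \<in> B \<Longrightarrow> h b \<in> span F" "\<And>b. b \<in> B \<Longrightarrow> b - h b \<in> W" by metis
  have zero: "r i = 0" if A: "finite A" "A \<subseteq> B" "(\<Sum>b\<in>A. smul (r b) (h b)) = 0" "i \<in> A" for A r i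
  proof -
    have "(\<Sum>b\<in>A. smul (r b) b) = (\<Sum>b\<in>A. smul (r b) (b - h b))"
      using A(3) by (simp add: scale_right_diff_distrib sum_subtractf)
    also have "\<dots> \<in> W" using A(2) h(2) by (intro subspace_sum[OF W] subspace_scale[OF W]) auto
    finally have "(\<Sum>b\<in>A. smul (r b) b) \<in> W" .
    moreover have "(\<Sum>b\<in>A. smul (r b) b) \<in> span B"
      using A(2) by (intro span_sum span_scale span_base) blast
    ultimately have "(\<Sum>b\<in>A. smul (r b) b) = 0" using B(3) by blast
    then show ?thesis using independentD[OF B(1) A(1,2)] A(4) by blast
  qed
  have "inj_on h B" "independent (h ` B)"
    by (rule independent_familyI, rule zero, assumption+)+
  moreover have "h ` B \<subseteq> span F" using h(1) by blast
  ultimately show False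
    using independent_span_bound[OF F] B(2) finite_image_iff by blast
qed

text \<open>
  Passing to the kernel of a functional lowers the dimension of \<open>M\<close> modulo \<open>N\<close> by at most one. That this
  dimension is infinite is expressed by saying that finitely many vectors \<open>F\<close> never make up for the difference.
\<close>
lemma kernel_not_subset_span:
  assumes M: "subspace M" and f: "bounded_functional f"
    and inf: "\<And>F. finite F \<Longrightarrow> \<not> M \<subseteq> span (N \<union> F)" and F: "finite F"
  shows "\<not> M \<inter> {x. f x = 0} \<subseteq> span (N \<union> F)"
proof
  assume sub: "M \<inter> {x. f x = 0} \<subseteq> span (N \<union> F)"
  show False
  proof (cases "\<forall>x\<in>M. f x = 0")
    case True
    then show False using sub inf[OF F] by blast
  next
    case False
    then obtain y where y: "y \<in> M" "f y \<noteq> 0" by blast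
    have "M \<subseteq> span (N \<union> insert y F)"
    proof
      fix x assume x: "x \<in> M"
      have "x - smul (f x / f y) y \<in> M \<inter> {x. f x = 0}"
        using x y M by (simp add: subspace_diff subspace_scale bounded_functional_linear[OF f] bounded_functionalD[OF f])
      then have "x - smul (f x / f y) y \<in> span (N \<union> F)" using sub by blast
      then show "x \<in> span (N \<union> insert y F)" unfolding Un_insert_right span_breakdown_eq by blast
    qed
    then show False using inf[of "insert y F"] F by blast
  qed
qed

lemma kernels_not_subset_span:
  fixes f :: "nat \<Rightarrow> 'v \<Rightarrow> 'k"
  assumes M: "subspace M" and f: "\<And>i. i < k \<Longrightarrow> bounded_functional (f i)"
    and inf: "\<And>F. finite F \<Longrightarrow> \<not> M \<subseteq> span (N \<union> F)" and F: "finite F"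
  shows "\<not> {x\<in>M. \<forall>i<k. f i x = 0} \<subseteq> span (N \<union> F)"
  using f F
proof (induction k arbitrary: F)
  case 0
  then show ?case using inf by simp
next
  case (Suc k)
  have "subspace {x\<in>M. \<forall>i<k. f i x = 0}"
    using M Suc.prems(1) by (intro subspaceI)
      (auto simp: subspace_0 subspace_add subspace_scale bounded_functional_linear bounded_functionalD)
  from kernel_not_subset_span[OF this, of "f k" N F] Suc
  have "\<not> {x\<in>M. \<forall>i<k. f i x = 0} \<inter> {x. f k x = 0} \<subseteq> span (N \<union> F)" by simp
  moreover have "{x\<in>M. \<forall>i<k. f i x = 0} \<inter> {x. f k x = 0} = {x\<in>M. \<forall>i<Suc k. f i x = 0}"
    by (auto simp: less_Suc_eq)
  ultimately show ?case by simp
qed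

section \<open>Triangular systems\<close>

text \<open>
  A one-sided form of biorthogonality: a new pair only has to respect the earlier functionals, so that pairs
  can be added one after the other, and coefficients can still be recovered from the first to the last.
\<close>
definition triangular_system :: "(nat \<Rightarrow> 'v) \<Rightarrow> (nat \<Rightarrow> 'v \<Rightarrow> 'k) \<Rightarrow> bool" where
  "triangular_system x f \<longleftrightarrow>
     (\<forall>k. bounded_functional (f k) \<and> f k (x k) \<noteq> 0 \<and> (\<forall>i<k. f i (x k) = 0))"

text \<open>
  Finitely many functionals cannot cut \<open>M\<close> down to a subset of \<open>N\<close>, so some \<open>x\<close> in \<open>M - N\<close> is annihilated by all
  earlier ones. Since \<open>N\<close> is closed, a functional separates \<open>N\<close> from a ball around \<open>x\<close>.
\<close>
lemma exists_triangular_system: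
  assumes M: "subspace M" and N: "subspace N" "closed N"
    and inf: "\<And>F. finite F \<Longrightarrow> \<not> M \<subseteq> span (N \<union> F)"
  shows "\<exists>x f. triangular_system x f \<and> range x \<subseteq> M \<and> (\<forall>k. \<forall>y\<in>N. f k y = 0)"
proof -
  \<comment> \<open>\<open>P h k r\<close>: the pair \<open>r\<close> may be put in position \<open>k\<close> after the pairs \<open>h 0, \<dots>, h (k - 1)\<close>.\<close>
  define P :: "(nat \<Rightarrow> 'v \<times> ('v \<Rightarrow> 'k)) \<Rightarrow> nat \<Rightarrow> 'v \<times> ('v \<Rightarrow> 'k) \<Rightarrow> bool" where
    "P h k = (\<lambda>(x, f). x \<in> M \<and> bounded_functional f \<and> f x \<noteq> 0 \<and> (\<forall>y\<in>N. f y = 0) \<and>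
       (\<forall>i<k. snd (h i) x = 0))" for h k
  have "\<exists>h. \<forall>k. P h k (h k)"
  proof (rule dependent_wellorder_choice)
    show "P h k r = P h' k r" if "\<And>i. i < k \<Longrightarrow> h i = h' i" for r h h' k
      using that by (auto simp: P_def)
    show "\<exists>r. P h k r" if "\<And>i. i < k \<Longrightarrow> P h i (h i)" for k h
    proof -
      have "bounded_functional (snd (h i))" if "i < k" for i
        using \<open>\<And>i. i < k \<Longrightarrow> P h i (h i)\<close>[OF that] by (auto simp: P_def)
      from kernels_not_subset_span[OF M _ inf, of k "\<lambda>i. snd (h i)" "{}"] this
      have "\<not> {x\<in>M. \<forall>i<k. snd (h i) x = 0} \<subseteq> N"
        using span_eq_iff[THEN iffD2, OF N(1)] by simp
      then obtain x where x: "x \<in> M" "\<forall>i<k. snd (h i) x = 0" "x \<notin> N" by blast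
      obtain r where r: "0 < r" "ball x r \<inter> N = {}"
        using exists_ball_avoiding_closed[OF N(2) x(3)] by blast
      obtain f where f: "bounded_functional f" "\<forall>y\<in>N. f y = 0" "\<And>y. f y = 0 \<Longrightarrow> y \<notin> ball x r"
        using exists_functional_avoiding_ball[OF N(1) r(2,1)] by metis
      have "f x \<noteq> 0" using f(3)[of x] r(1) by auto
      then have "P h k (x, f)" using f(1,2) x(1,2) by (simp add: P_def)
      then show ?thesis ..
    qed
  qed
  then obtain h where h: "\<And>k. P h k (h k)" by blast
  have "fst (h k) \<in> M \<and> bounded_functional (snd (h k)) \<and> snd (h k) (fst (h k)) \<noteq> 0 \<and>
      (\<forall>y\<in>N. snd (h k) y = 0) \<and> (\<forall>i<k. snd (h i) (fst (h k)) = 0)" for k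
    using h[of k] unfolding P_def case_prod_unfold .
  then show ?thesis
    unfolding triangular_system_def
    by (intro exI[of _ "\<lambda>k. fst (h k)"] exI[of _ "\<lambda>k. snd (h k)"]) blast
qed

text \<open>
  Apply \<open>f\<^sub>i\<close> to the series: the terms before \<open>i\<close> vanish by induction, those after \<open>i\<close> by triangularity.
\<close>
lemma triangular_system_series_coefficients:
  assumes tri: "triangular_system x f" and s: "(\<lambda>k. smul (b k) (x k)) sums y"
    and y: "\<And>i. f i y = 0"
  shows "b i = 0"
proof (induction i rule: less_induct)
  case (less i)
  have f: "bounded_functional (f i)" and fi: "f i (x i) \<noteq> 0"
    using tri by (auto simp: triangular_system_def)
  have "f i (smul (b k) (x k)) = 0" if "k \<noteq> i" for k
  proof (cases "k < i")
    case True
    then show ?thesis using less by (simp add: bounded_functional_linear[OF f])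
  next
    case False
    then show ?thesis using that tri by (simp add: bounded_functionalD[OF f] triangular_system_def)
  qed
  then have "(\<lambda>k. f i (smul (b k) (x k))) sums f i (smul (b i) (x i))"
    using sums_finite[of "{i}" "\<lambda>k. f i (smul (b k) (x k))"] by auto
  moreover have "(\<lambda>k. f i (smul (b k) (x k))) sums f i y"
    by (rule bounded_linear.sums[OF bounded_functionalD(1)[OF f] s])
  ultimately have "b i * f i (x i) = 0" using y[of i] sums_unique2 bounded_functionalD(2)[OF f] by metis
  then show ?case using fi by simp
qed

end

section \<open>Separability and the dimension of separable closed subspaces\<close>

text \<open>
  The hypothesis extends linearly from the powers of \<open>t\<close> to all polynomials; take the one that vanishes on \<open>A\<close>
  except at \<open>s\<close>.
\<close>
lemma coefficients_zero_if_power_sums_zero: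
  fixes r :: "real \<Rightarrow> 'k::real_normed_field"
  assumes A: "finite A" and zero: "\<And>k. (\<Sum>t\<in>A. r t * of_real (t ^ k)) = 0" and s: "s \<in> A"
  shows "r s = 0"
proof -
  define p :: "real poly" where "p = (\<Prod>t\<in>A - {s}. [:- t, 1:])"
  have p: "poly p t = (\<Prod>u\<in>A - {s}. t - u)" for t
    by (simp add: p_def poly_prod)
  have "(\<Sum>t\<in>A. r t * of_real (poly p t))
      = (\<Sum>t\<in>A. \<Sum>i\<le>degree p. of_real (coeff p i) * (r t * of_real (t ^ i)))"
    by (simp add: poly_altdef sum_distrib_left algebra_simps)
  also have "\<dots> = (\<Sum>i\<le>degree p. of_real (coeff p i) * (\<Sum>t\<in>A. r t * of_real (t ^ i)))"
    by (subst sum.swap) (simp add: sum_distrib_left)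
  also have "\<dots> = 0" by (simp only: zero) simp
  finally have "(\<Sum>t\<in>A. r t * of_real (poly p t)) = 0" .
  moreover have "(\<Sum>t\<in>A. r t * of_real (poly p t)) = (\<Sum>t\<in>{s}. r t * of_real (poly p t))"
    using A s by (intro sum.mono_neutral_right) (auto simp: p)
  moreover have "poly p s \<noteq> 0" using A by (auto simp: p)
  ultimately show ?thesis by simp
qed

text \<open>
  A point of the closure is determined by the set of balls of radius \<open>1/(j+1)\<close> around points of \<open>D\<close> that
  contain it, that is, by a set of natural numbers.
\<close>
lemma card_of_closure_countable:
  fixes D :: "'a::metric_space set"
  assumes "countable D"
  shows "|closure D| \<le>o |UNIV :: real set|"
proof -
  define code where "code x = {n. dist (from_nat_into D (fst (prod_decode n))) x
      < inverse (real (Suc (snd (prod_decode n))))}" for x :: 'a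
  have "inj_on code (closure D)"
  proof (rule inj_onI, rule ccontr)
    fix x y assume xy: "x \<in> closure D" "y \<in> closure D" "code x = code y" "x \<noteq> y"
    obtain j where j: "inverse (real (Suc j)) < dist x y / 2"
      using reals_Archimedean[of "dist x y / 2"] xy(4) by auto
    obtain z where "z \<in> D" "dist z x < inverse (real (Suc j))"
      using xy(1) unfolding closure_approachable by (metis inverse_positive_iff_positive of_nat_0_less_iff zero_less_Suc)
    then obtain i where i: "dist (from_nat_into D i) x < inverse (real (Suc j))"
      using assms from_nat_into_surj by metis
    then have "prod_encode (i, j) \<in> code x" by (simp add: code_def)
    then have "prod_encode (i, j) \<in> code y" using xy(3) by simp
    then have "dist (from_nat_into D i) y < inverse (real (Suc j))" by (simp add: code_def)
    then show False using i j dist_triangle3[of x y "from_nat_into D i"] by linarith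
  qed
  then have "|closure D| \<le>o |UNIV :: nat set set|"
    using card_of_ordLeq by blast
  also have "|UNIV :: nat set set| =o |UNIV :: real set|"
    using nat_sets_eqpoll_reals by (simp add: eqpoll_iff_card_of_ordIso)
  finally show ?thesis .
qed

context banach_space_over
begin

text \<open>
  Combinations with coefficients from a countable dense set of scalars are dense in the span.
\<close>
lemma exists_countable_dense_span:
  assumes "countable Z"
  shows "\<exists>D. countable D \<and> span Z \<subseteq> closure D"
proof -
  obtain Q :: "'k set" where Q: "countable Q" "\<And>X. open X \<Longrightarrow> X \<noteq> {} \<Longrightarrow> \<exists>d\<in>Q. d \<in> X"
    using countable_dense_setE by metis
  have dense: "closure Q = UNIV"
    using Q(2)[of "- closure Q"] closure_subset[of Q] by auto
  define D where "D = (\<lambda>l. \<Sum>(q, z)\<leftarrow>l. smul q z) ` lists (Q \<times> Z)"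
  have "countable D" unfolding D_def using Q(1) assms by auto
  moreover have "x \<in> closure D" if "x \<in> span Z" for x
    using that
  proof (induction rule: span_induct_alt)
    case base
    have "0 \<in> D" unfolding D_def by (auto intro!: image_eqI[of _ _ "[]"])
    then show ?case using closure_subset by blast
  next
    case (step c x y)
    have "(\<lambda>(q, y). smul q x + y) ` closure (Q \<times> D) \<subseteq> closure D"
    proof (rule image_closure_subset)
      show "continuous_on (closure (Q \<times> D)) (\<lambda>(q, y). smul q x + y)"
        unfolding case_prod_unfold
        by (intro continuous_intros linear_continuous_on
            bounded_linear_compose[OF bounded_linear_smul_left bounded_linear_fst])
      have "smul q x + y \<in> D" if q: "q \<in> Q" and y: "y \<in> D" for q y
      proof -
        obtain l where "l \<in> lists (Q \<times> Z)" "y = (\<Sum>(q, z)\<leftarrow>l. smul q z)"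
          using y by (auto simp: D_def)
        then show ?thesis unfolding D_def
          using q step(1) by (intro image_eqI[of _ _ "(q, x) # l"]) auto
      qed
      then show "(\<lambda>(q, y). smul q x + y) ` (Q \<times> D) \<subseteq> closure D"
        using closure_subset by fastforce
    qed simp
    then show ?case using step(2) dense by (auto simp: closure_Times)
  qed
  ultimately show ?thesis by blast
qed

text \<open>
  A subspace with a countable dense subset has at most as many points as there are sets of naturals,
  so every algebraic basis of it has at most continuum many elements.
\<close>
lemma card_of_closure_span_countable:
  assumes "countable Z"
  shows "|closure (span Z)| \<le>o |UNIV :: real set|"
proof -
  obtain D where D: "countable D" "span Z \<subseteq> closure D"
    using exists_countable_dense_span[OF assms] by blast
  have "closure (span Z) \<subseteq> closure D" using D(2) by (rule closure_minimal) simp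
  then have "|closure (span Z)| \<le>o |closure D|" by (rule card_of_mono1)
  then show ?thesis using card_of_closure_countable[OF D(1)] by (rule ordLeq_transitive)
qed

text \<open>
  The vectors are \<open>v(t) = (\<Sum>k. t\<^sup>k x\<^sub>k / \<parallel>x\<^sub>k\<parallel>)\<close> for a triangular system \<open>(x\<^sub>k)\<close> in \<open>T\<close>. A finite relation
  \<open>(\<Sum>t. r\<^sub>t v(t)) = 0\<close> is a series in the \<open>x\<^sub>k\<close> with sum \<open>0\<close>, so its coefficients vanish: \<open>(\<Sum>t. r\<^sub>t t\<^sup>k) = 0\<close>
  for all \<open>k\<close>.
\<close>
lemma exists_continuum_independent_family:
  assumes T: "subspace T" "closed T" and inf: "\<And>F. finite F \<Longrightarrow> \<not> T \<subseteq> span F"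
  shows "\<exists>v :: real \<Rightarrow> 'v. v ` {0<..<1} \<subseteq> T \<and> inj_on v {0<..<1} \<and> independent (v ` {0<..<1})"
proof -
  have "\<not> T \<subseteq> span ({0} \<union> F)" if "finite F" for F using inf[OF that] by simp
  from exists_triangular_system[OF T(1) subspace_single_0 closed_singleton this]
  obtain x f where tri: "triangular_system x f" and x: "range x \<subseteq> T" by blast
  have f: "bounded_functional (f k)" for k using tri by (auto simp: triangular_system_def)
  have x_nonzero: "x k \<noteq> 0" for k
    using tri bounded_functional_linear(3)[OF f] unfolding triangular_system_def by metis
  define b where "b k = inverse (norm (x k))" for k
  define v where "v t = (\<Sum>k. (t ^ k * b k) *\<^sub>R x k)" for t
  have v: "(\<lambda>k. smul (of_real (t ^ k) * of_real (b k)) (x k)) sums v t" if "t \<in> {0<..<1}" for t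
  proof -
    have "norm ((t ^ k * b k) *\<^sub>R x k) = t ^ k" for k
      using that x_nonzero[of k] by (simp add: b_def)
    then have "summable (\<lambda>k. norm ((t ^ k * b k) *\<^sub>R x k))"
      using that by (simp add: summable_geometric)
    then have "(\<lambda>k. (t ^ k * b k) *\<^sub>R x k) sums v t"
      unfolding v_def by (rule summable_sums[OF summable_norm_cancel])
    then show ?thesis by (simp only: smul_of_real[symmetric] of_real_mult)
  qed
  have "v t \<in> T" if "t \<in> {0<..<1}" for t
  proof -
    have "(\<Sum>k<n. smul (of_real (t ^ k) * of_real (b k)) (x k)) \<in> T" for n
      using x by (intro subspace_sum[OF T(1)] subspace_scale[OF T(1)]) auto
    then show ?thesis
      using v[OF that] T(2) unfolding sums_def by (meson closed_sequentially)
  qed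
  moreover have "r i = 0" if A: "finite A" "A \<subseteq> {0<..<1}" and zero: "(\<Sum>t\<in>A. smul (r t) (v t)) = 0"
    and i: "i \<in> A" for A :: "real set" and r :: "real \<Rightarrow> 'k" and i
  proof (rule coefficients_zero_if_power_sums_zero[OF A(1) _ i])
    fix k
    have "(\<lambda>k. \<Sum>t\<in>A. smul (r t) (smul (of_real (t ^ k) * of_real (b k)) (x k))) sums (\<Sum>t\<in>A. smul (r t) (v t))"
      using A(2) by (intro sums_sum bounded_linear.sums[OF bounded_linear_smul_right] v) auto
    moreover have "(\<Sum>t\<in>A. smul (r t) (smul (of_real (t ^ k) * of_real (b k)) (x k)))
        = smul ((\<Sum>t\<in>A. r t * of_real (t ^ k)) * of_real (b k)) (x k)" for k
      by (simp add: scale_sum_left sum_distrib_right mult.assoc)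
    ultimately have "(\<lambda>k. smul ((\<Sum>t\<in>A. r t * of_real (t ^ k)) * of_real (b k)) (x k)) sums 0"
      using zero by simp
    from triangular_system_series_coefficients[OF tri this bounded_functional_linear(3)[OF f], of k]
    show "(\<Sum>t\<in>A. r t * of_real (t ^ k)) = 0"
      using x_nonzero[of k] by (simp add: b_def)
  qed
  ultimately show ?thesis
    using independent_familyI[of "{0<..<1}" v] by (intro exI[of _ v] conjI image_subsetI) simp_all
qed

lemma has_hamel_dim_continuum:
  assumes T: "subspace T" "closed T" and inf: "\<And>F. finite F \<Longrightarrow> \<not> T \<subseteq> span F"
    and card: "|T| \<le>o |UNIV :: real set|"
  shows "has_hamel_dim smul T |UNIV :: real set|"
proof -
  obtain v :: "real \<Rightarrow> 'v" where v: "v ` {0<..<1} \<subseteq> T" "inj_on v {0<..<1}" "independent (v ` {0<..<1})"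
    using exists_continuum_independent_family[OF T inf] by blast
  obtain B where B: "v ` {0<..<1} \<subseteq> B" "B \<subseteq> T" "independent B" "T \<subseteq> span B"
    using maximal_independent_subset_extend[OF v(1,3)] by blast
  have "span B = T" using B(2,4) span_minimal[OF B(2) T(1)] by blast
  moreover have "|B| =o |UNIV :: real set|"
  proof -
    have "|UNIV :: real set| =o |{0<..<1::real}|"
      using open_interval_eqpoll_reals[of 0 1] by (auto simp: eqpoll_iff_card_of_ordIso intro: ordIso_symmetric)
    also have "|{0<..<1::real}| \<le>o |B|" using v(2) B(1) card_of_ordLeq by blast
    finally have "|UNIV :: real set| \<le>o |B|" .
    moreover have "|B| \<le>o |UNIV :: real set|"
      using card_of_mono1[OF B(2)] card by (rule ordLeq_transitive)
    ultimately show ?thesis by (simp add: ordIso_iff_ordLeq)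
  qed
  ultimately show ?thesis using B(3) unfolding has_hamel_dim_def by blast
qed

section \<open>The small operator and the extension\<close>

text \<open>
  For each \<open>d\<close> in \<open>D\<close> take a functional whose kernel has distance at least \<open>\<parallel>d\<parallel>\<close> from \<open>d\<close>. A common zero \<open>y\<close>
  in the closure of \<open>D\<close> is approximated by some \<open>d\<close>, and then \<open>\<parallel>d\<parallel> \<le> \<parallel>d - y\<parallel>\<close> is as small as desired.
\<close>
lemma exists_total_functionals:
  assumes D: "countable D"
  shows "\<exists>g :: nat \<Rightarrow> 'v \<Rightarrow> 'k. (\<forall>k. bounded_functional (g k)) \<and>
    (\<forall>y\<in>closure D. (\<forall>k. g k y = 0) \<longrightarrow> y = 0)"
proof -
  have "\<exists>f. bounded_functional f \<and> (\<forall>y. f y = 0 \<longrightarrow> norm d \<le> dist d y)" for d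
  \<comment> \<open>For \<open>d = 0\<close> the distance condition is void, and any functional serves.\<close>
  proof (cases "d = 0")
    case True
    have "bounded_functional (\<lambda>x. 0)" by (simp add: bounded_functional_def bounded_linear_zero)
    then show ?thesis using True by auto
  next
    case False
    have "ball d (norm d) \<inter> {0} = {}" by (auto simp: dist_norm)
    from exists_functional_avoiding_ball[OF _ this] False show ?thesis
      by (auto simp: not_less)
  qed
  then obtain f where f: "\<And>d. bounded_functional (f d)" "\<And>d y. f d y = 0 \<Longrightarrow> norm d \<le> dist d y"
    by metis
  have "y = 0" if y: "y \<in> closure D" and zero: "\<And>k. f (from_nat_into D k) y = 0" for y
  proof (rule ccontr)
    assume "y \<noteq> 0"
    then obtain d where d: "d \<in> D" "dist d y < norm y / 2"
      using y unfolding closure_approachable by (metis half_gt_zero zero_less_norm_iff)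
    then have "norm d \<le> dist d y" using f(2) zero from_nat_into_surj[OF D] by metis
    moreover have "norm y \<le> norm d + dist d y"
      by (metis dist_norm norm_minus_commute norm_triangle_sub)
    ultimately show False using d(2) by linarith
  qed
  then show ?thesis
    using f(1) by (intro exI[of _ "\<lambda>k. f (from_nat_into D k)"] conjI allI ballI impI) auto
qed

text \<open>
  The scalars \<open>\<delta>\<^sub>k\<close> only have to be small enough in terms of the norms of \<open>g\<^sub>k\<close> and \<open>x\<^sub>k\<close>.
\<close>
lemma exists_small_series_operator:
  assumes g: "\<And>k :: nat. bounded_functional (g k)"
  shows "\<exists>\<delta> K. (\<forall>k. \<delta> k \<noteq> 0) \<and> (\<forall>u. (\<lambda>k. smul (\<delta> k * g k u) (x k)) sums K u) \<and>
    (\<forall>u w. K (u + w) = K u + K w) \<and> (\<forall>a u. K (smul a u) = smul a (K u)) \<and>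
    (\<forall>u. norm (K u) \<le> norm u / 2)"
proof -
  have "\<exists>C>0. \<forall>u. norm (g k u) \<le> norm u * C" for k
    using bounded_linear.pos_bounded[OF bounded_functionalD(1)[OF g]] .
  then obtain C where C: "\<And>k. C k > 0" "\<And>k u. norm (g k u) \<le> norm u * C k" by metis
  \<comment> \<open>The exponent \<open>k + 2\<close> makes the bounds add up to \<open>\<parallel>u\<parallel> / 2\<close>; adding \<open>1\<close> to \<open>\<parallel>x\<^sub>k\<parallel>\<close> avoids dividing by \<open>0\<close>.\<close>
  define d where "d k = (1/2) ^ (k + 2) / (C k * (norm (x k) + 1))" for k
  define \<delta> :: "nat \<Rightarrow> 'k" where "\<delta> k = of_real (d k)" for k
  define K where "K u = (\<Sum>k. smul (\<delta> k * g k u) (x k))" for u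
  have d: "d k > 0" for k
    using C(1) by (auto simp: d_def intro!: divide_pos_pos mult_pos_pos add_nonneg_pos)
  have bound: "norm (smul (\<delta> k * g k u) (x k)) \<le> norm u * (1/2) ^ (k + 2)" for k u
  proof -
    have "norm (smul (\<delta> k * g k u) (x k)) = d k * norm (g k u) * norm (x k)"
      using d[of k] by (simp add: norm_smul norm_mult \<delta>_def)
    also have "\<dots> \<le> d k * (norm u * C k) * (norm (x k) + 1)"
      using d[of k] C(1)[of k] C(2)[of k u] by (intro mult_mono) auto
    also have "\<dots> = norm u * (1/2) ^ (k + 2)"
    proof -
      have "C k \<noteq> 0" "norm (x k) + 1 \<noteq> 0" using C(1)[of k] norm_ge_zero[of "x k"] by linarith+
      moreover have "h / (c * m) * (a * c) * m = a * h" if "c \<noteq> 0" "m \<noteq> 0" for a c h m :: real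
        using that by simp
      ultimately show ?thesis unfolding d_def by blast
    qed
    finally show ?thesis .
  qed
  have geo: "(\<lambda>k. norm u * (1/2) ^ (k + 2)) sums (norm u / 2)" for u :: 'v
  proof -
    have "(\<lambda>k. norm u / 4 * (1/2) ^ k) sums (norm u / 4 * (1 / (1 - 1/2)))"
      by (intro sums_mult geometric_sums) simp
    then show ?thesis by (simp add: power_add mult.commute)
  qed
  have abs_summable: "summable (\<lambda>k. norm (smul (\<delta> k * g k u) (x k)))" for u
    by (rule summable_comparison_test'[OF sums_summable[OF geo[of u]], of 0]) (use bound in simp)
  have K: "(\<lambda>k. smul (\<delta> k * g k u) (x k)) sums K u" for u
    unfolding K_def by (rule summable_sums[OF summable_norm_cancel[OF abs_summable]])
  have "K (u + w) = K u + K w" for u w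
    using sums_add[OF K[of u] K[of w]] K[of "u + w"]
    by (intro sums_unique2[of _ "K (u + w)"])
      (simp_all add: bounded_functional_linear[OF g] distrib_left scale_left_distrib)
  moreover have "K (smul a u) = smul a (K u)" for a u
    using bounded_linear.sums[OF bounded_linear_smul_right K[of u], of a] K[of "smul a u"]
    by (intro sums_unique2[of _ "K (smul a u)"]) (simp_all add: bounded_functionalD[OF g] mult.left_commute)
  moreover have "norm (K u) \<le> norm u / 2" for u
  proof -
    have "norm (K u) \<le> (\<Sum>k. norm (smul (\<delta> k * g k u) (x k)))"
      unfolding K_def by (rule summable_norm[OF abs_summable])
    also have "\<dots> \<le> (\<Sum>k. norm u * (1/2) ^ (k + 2))"
      by (rule suminf_le[OF bound abs_summable sums_summable[OF geo]])
    also have "\<dots> = norm u / 2" using geo sums_unique by metis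
    finally show ?thesis .
  qed
  moreover have "\<delta> k \<noteq> 0" for k using d[of k] by (simp add: \<delta>_def)
  ultimately show ?thesis using K by (intro exI[of _ \<delta>] exI[of _ K] conjI allI) simp_all
qed

text \<open>
  The images \<open>J u\<close> form a complete set, because \<open>J\<close> is injective on \<open>E\<close> with bounded inverse.
\<close>
lemma closed_subspace_image_bounded_below:
  assumes J: "bounded_linear J" and J_scale: "\<And>a u. J (smul a u) = smul a (J u)"
    and lower: "\<And>u. 1/2 * norm u \<le> norm (J u)" and E: "subspace E" "closed E"
  shows "subspace (J ` E)" "closed (J ` E)"
proof -
  interpret J: bounded_linear J by fact
  show "subspace (J ` E)"
  proof (rule subspaceI)
    show "0 \<in> J ` E" using imageI[OF subspace_0[OF E(1)], of J] J.zero by simp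
    show "y + z \<in> J ` E" if "y \<in> J ` E" "z \<in> J ` E" for y z
      using that by (auto simp flip: J.add intro!: imageI subspace_add[OF E(1)])
    show "smul a y \<in> J ` E" if "y \<in> J ` E" for a y
      using that by (auto simp flip: J_scale intro!: imageI subspace_scale[OF E(1)])
  qed
  have "complete (J ` E)"
    by (rule complete_isometric_image[of "1/2", OF _ real_subspace[OF E(1)] J])
      (use lower E(2) in \<open>auto simp: complete_eq_closed\<close>)
  then show "closed (J ` E)" by (simp add: complete_eq_closed)
qed

lemma independent_image_bounded_below:
  assumes J: "bounded_linear J" and J_scale: "\<And>a u. J (smul a u) = smul a (J u)"
    and lower: "\<And>u. 1/2 * norm u \<le> norm (J u)" and B: "independent B"
  shows "inj_on J B" "independent (J ` B)"
proof -
  have zero: "r i = 0" if A: "finite A" "A \<subseteq> B" "(\<Sum>b\<in>A. smul (r b) (J b)) = 0" "i \<in> A" for A r i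
  proof -
    have "J (\<Sum>b\<in>A. smul (r b) b) = 0"
      using A(3) by (simp add: bounded_linear.linear[OF J] linear_sum J_scale)
    then have "(\<Sum>b\<in>A. smul (r b) b) = 0" using lower[of "\<Sum>b\<in>A. smul (r b) b"] by simp
    then show ?thesis using independentD[OF B A(1,2)] A(4) by blast
  qed
  show "inj_on J B" "independent (J ` B)"
    by (rule independent_familyI, rule zero, assumption+)+
qed

text \<open>
  The space \<open>T\<close> is \<open>(I + K) E + span C\<close> for \<open>E\<close> the closed span of \<open>e\<close> and an operator \<open>K\<close> that maps
  no nonzero vector of \<open>E\<close> into \<open>W + span C\<close>.
\<close>
lemma exists_closed_continuum_dim_extension:
  assumes W: "subspace W" "closed W"
    and B: "independent B" "infinite B" "span B \<inter> W \<subseteq> {0}"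
    and e: "range e \<subseteq> W" "inj (e :: nat \<Rightarrow> 'v)" "independent (range e)"
    and C: "finite C" "span C \<inter> W \<subseteq> {0}"
  shows "\<exists>T. subspace T \<and> closed T \<and> has_hamel_dim smul T |UNIV :: real set| \<and>
    span C \<subseteq> T \<and> T \<inter> W \<subseteq> {0}"
proof -
  define N where "N = span (W \<union> C)"
  have N: "subspace N" "closed N" "W \<subseteq> N" "span C \<subseteq> N"
    unfolding N_def using closed_span_Un_finite[OF C(1) W] span_superset[of "W \<union> C"]
    by (auto intro: span_mono[THEN subsetD])
  have "\<not> UNIV \<subseteq> span (N \<union> F)" if F: "finite F" for F
  proof -
    have "N \<subseteq> span (W \<union> (C \<union> F))" unfolding N_def by (rule span_mono) blast
    moreover have "F \<subseteq> span (W \<union> (C \<union> F))" using span_superset[of "W \<union> (C \<union> F)"] by blast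
    ultimately have "span (N \<union> F) \<subseteq> span (W \<union> (C \<union> F))" by (intro span_minimal) auto
    then show ?thesis
      using independent_not_subset_span_Un_finite[OF W(1) B, of "C \<union> F"] C(1) F by auto
  qed
  from exists_triangular_system[OF subspace_UNIV N(1,2) this]
  obtain x f where tri: "triangular_system x f" and f: "\<And>k y. y \<in> N \<Longrightarrow> f k y = 0" by blast

  define E where "E = closure (span (range e))"
  have E: "subspace E" "closed E" "range e \<subseteq> E" "E \<subseteq> W"
    unfolding E_def using closure_minimal[OF span_minimal[OF e(1) W(1)] W(2)]
      span_superset[of "range e"] closure_subset[of "span (range e)"]
    by (auto intro: subspace_closure)
  obtain D where D: "countable D" "span (range e) \<subseteq> closure D"
    using exists_countable_dense_span[of "range e"] by auto
  have ED: "E \<subseteq> closure D" unfolding E_def using D(2) by (rule closure_minimal) simp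
  obtain g :: "nat \<Rightarrow> 'v \<Rightarrow> 'k" where g: "\<And>k. bounded_functional (g k)"
    and total: "\<And>y. y \<in> closure D \<Longrightarrow> (\<forall>k. g k y = 0) \<Longrightarrow> y = 0"
    using exists_total_functionals[OF D(1)] by blast
  obtain \<delta> K where \<delta>: "\<And>k. \<delta> k \<noteq> 0" and K: "\<And>u. (\<lambda>k. smul (\<delta> k * g k u) (x k)) sums K u"
    and K_add: "\<And>u w. K (u + w) = K u + K w" and K_scale: "\<And>a u. K (smul a u) = smul a (K u)"
    and K_small: "\<And>u. norm (K u) \<le> norm u / 2"
    using exists_small_series_operator[of g x, OF g] by blast
  have K_inj: "u = 0" if "u \<in> E" "K u \<in> N" for u
  proof -
    have "\<delta> k * g k u = 0" for k
      by (rule triangular_system_series_coefficients[OF tri K f[OF that(2)]])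
    then show ?thesis using \<delta> total ED that(1) by auto
  qed

  define J where "J u = u + K u" for u
  have J_add: "J (u + w) = J u + J w" and J_scale: "J (smul a u) = smul a (J u)" for a u w
    by (simp_all add: J_def K_add K_scale scale_right_distrib)
  have J_lower: "norm (J u) \<ge> 1/2 * norm u" and J_upper: "norm (J u) \<le> norm u * 2" for u
  proof -
    have "norm u \<le> norm (J u) + norm (K u)" "norm (J u) \<le> norm u + norm (K u)"
      unfolding J_def using norm_triangle_ineq4[of "u + K u" "K u"] norm_triangle_ineq by auto
    then show "norm (J u) \<ge> 1/2 * norm u" "norm (J u) \<le> norm u * 2"
      using K_small[of u] norm_ge_zero[of u] by linarith+
  qed
  have J: "bounded_linear J"
    using J_scale[of "of_real _"] J_add J_upper by (intro bounded_linear_intro) (simp_all add: smul_of_real)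
  have J_zero: "J 0 = 0" using J_scale[of 0 0] by simp
  note JE = closed_subspace_image_bounded_below[OF J J_scale J_lower E(1,2)]

  define T where "T = span (J ` E \<union> C)"
  have T: "subspace T" "closed T"
    unfolding T_def using closed_span_Un_finite[OF C(1) JE] by simp_all
  have "J ` E \<subseteq> T" "span C \<subseteq> T"
    unfolding T_def using span_superset[of "J ` E \<union> C"] by (auto intro: span_mono[THEN subsetD])
  have T_cases: "\<exists>u\<in>E. \<exists>s\<in>span C. y = J u + s" if "y \<in> T" for y
  proof -
    have spanJE: "span (J ` E) = J ` E" using JE(1) by simp
    obtain z s where "z \<in> J ` E" "s \<in> span C" "y = z + s"
      using \<open>y \<in> T\<close> unfolding T_def span_Un spanJE by blast
    then show ?thesis by blast
  qed
  have "T \<inter> W \<subseteq> {0}"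
  proof
    fix y assume y: "y \<in> T \<inter> W"
    then obtain u s where us: "u \<in> E" "s \<in> span C" "y = J u + s" using T_cases by blast
    have "K u = (y - u) - s" using us(3) by (simp add: J_def)
    also have "\<dots> \<in> N"
    proof -
      have "y \<in> N" "u \<in> N" "s \<in> N" using y us(1,2) E(4) N(3,4) by blast+
      then show ?thesis by (intro subspace_diff[OF N(1)])
    qed
    finally have "u = 0" using K_inj us(1) by blast
    then have "y = s" using us(3) J_zero by simp
    then show "y \<in> {0}" using us(2) y C(2) by blast
  qed
  moreover have "has_hamel_dim smul T |UNIV :: real set|"
  proof (rule has_hamel_dim_continuum[OF T])
    fix F :: "'v set" assume F: "finite F"
    have "inj_on J (range e)" "independent (J ` range e)"
      using independent_image_bounded_below[OF J J_scale J_lower e(3)] by blast+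
    moreover have "infinite (range e)" using e(2) by (simp add: finite_image_iff)
    ultimately have "\<not> J ` range e \<subseteq> span F"
      using independent_span_bound[OF F] finite_image_iff by blast
    then show "\<not> T \<subseteq> span F" using \<open>J ` E \<subseteq> T\<close> E(3) by blast
  next
    have "countable (J ` D \<union> C)" using D(1) countable_finite[OF C(1)] by auto
    then have card: "|closure (span (J ` D \<union> C))| \<le>o |UNIV :: real set|"
      by (rule card_of_closure_span_countable)
    have "J ` E \<subseteq> closure (J ` D)"
      using ED closure_bounded_linear_image_subset[OF J, of D] by blast
    also have "\<dots> \<subseteq> closure (span (J ` D \<union> C))"
      using span_superset[of "J ` D \<union> C"] by (intro closure_mono) blast
    finally have "J ` E \<union> C \<subseteq> closure (span (J ` D \<union> C))"
      using closure_subset[of "span (J ` D \<union> C)"] span_superset[of "J ` D \<union> C"] by blast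
    then have "T \<subseteq> closure (span (J ` D \<union> C))"
      unfolding T_def by (intro span_minimal subspace_closure subspace_span)
    then have "|T| \<le>o |closure (span (J ` D \<union> C))|" by (rule card_of_mono1)
    then show "|T| \<le>o |UNIV :: real set|" using card by (rule ordLeq_transitive)
  qed
  ultimately show ?thesis using T \<open>span C \<subseteq> T\<close> by blast
qed

end

theorem theorem3p6:
  fixes smul :: "'k::{real_normed_field,euclidean_space} \<Rightarrow> 'v::banach \<Rightarrow> 'v"
    and \<kappa> :: "'c rel" and W :: "'v set" and n :: nat
  assumes "Card_order \<kappa>" and "|UNIV :: real set| \<le>o \<kappa>"
    and "banach_space_over smul"
    and "has_hamel_dim smul (UNIV :: 'v set) \<kappa>"
    and "module.subspace smul W" and "closed W"
    and "lineable smul natLeq (UNIV - W)"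
    and "\<exists>e. range e \<subseteq> W \<and> regular_basic_sequence smul e"
    and "n \<ge> 1"
  shows "spaceable smul |{..<n}| |UNIV :: real set| (UNIV - W)"
proof -
  interpret banach_space_over smul by fact
  obtain B where B: "independent B" "|B| =o natLeq" "span B \<subseteq> (UNIV - W) \<union> {0}"
    using assms(7) unfolding lineable_def has_hamel_dim_def by blast
  have "|B| =o |UNIV :: nat set|"
    using B(2) card_of_nat ordIso_symmetric ordIso_transitive by blast
  then have infB: "infinite B" using card_of_ordIso_finite by blast
  obtain e where "range e \<subseteq> W" "basic_sequence smul e"
    using assms(8) unfolding regular_basic_sequence_def by blast
  note e = this(1) basic_sequence_independent[OF this(2)]
  show ?thesis
    unfolding spaceable_def
  proof (intro conjI allI impI)
    show "|{..<n}| \<le>o |UNIV :: real set|"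
      by (rule ordLess_imp_ordLeq, rule finite_ordLess_infinite[OF card_of_Well_order card_of_Well_order])
        (simp_all add: Field_card_of infinite_UNIV_char_0)
    show "UNIV - W \<noteq> {}"
    proof
      assume "UNIV - W = {}"
      then have "B \<subseteq> {0}" using B(3) span_superset[of B] by blast
      then show False using infB finite_subset by blast
    qed
    show "lineable smul |{..<n}| (UNIV - W)"
    proof -
      obtain C where C: "C \<subseteq> B" "finite C" "card C = n"
        using infinite_arbitrarily_large[OF infB] by blast
      have "independent C" using B(1) C(1) independent_mono by blast
      moreover have "|C| =o |{..<n}|" 
        using finite_same_card_bij[OF C(2) finite_lessThan, of n] C(3) card_of_ordIsoI by auto
      moreover have "span C \<subseteq> (UNIV - W) \<union> {0}" using B(3) span_mono[OF C(1)] by blast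
      ultimately show ?thesis
        unfolding lineable_def has_hamel_dim_def by (intro exI[of _ "span C"]) auto
    qed
    fix S assume S: "subspace S \<and> has_hamel_dim smul S |{..<n}| \<and> S \<subseteq> UNIV - W \<union> {0}"
    then obtain C where C: "span C = S" "|C| =o |{..<n}|" unfolding has_hamel_dim_def by blast
    have "finite C" using card_of_ordIso_finite[OF C(2)] by simp
    from exists_closed_continuum_dim_extension[OF assms(5,6) B(1) infB _ e this] B(3) S C(1)
    obtain T where "subspace T" "closed T" "has_hamel_dim smul T |UNIV :: real set|" "S \<subseteq> T" "T \<inter> W \<subseteq> {0}"
      by blast
    then show "\<exists>T. subspace T \<and> closed T \<and> has_hamel_dim smul T |UNIV :: real set| \<and>
             S \<subseteq> T \<and> T \<subseteq> UNIV - W \<union> {0}" by blast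
  qed
qed

end
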